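(* Let $r,s\ge 1$ be integers, let $\mathbf{a}(z)\in\mathbb{C}[z]^{r\times r}$ be a matrix polynomial of degree $s$, and let $\mathbf{c}_0,\mathbf{d}_0\in\mathbb{C}^{r\times r}$. Suppose there are matrices $\mathbf{D_A},\mathbf{A}\in\mathbb{C}^{rs\times rs}$, $\mathbf{X_A}\in\mathbb{C}^{r\times rs}$, $\mathbf{Y_A}\in\mathbb{C}^{rs\times r}$ such that $\det\mathbf{a}(z)=\det(z\mathbf{D_A}-\mathbf{A})$ for all $z$, this polynomial is not identically zero (so that $z\mathbf{D_A}-\mathbf{A}$ is invertible except for $z$ in the discrete set $\Lambda(\mathbf{a})$), and $$\mathbf{a}^{-1}(z)=\mathbf{X_A}(z\mathbf{D_A}-\mathbf{A})^{-1}\mathbf{Y_A}\qquad\text{for all } z\in\mathbb{C}\setminus\Lambda(\mathbf{a}).$$ Define $$\mathbf{E}_1=\begin{bmatrix}\mathbf{0}&\mathbf{c}_0\mathbf{X_A}\\-\mathbf{Y_A}&\mathbf{A}\end{bmatrix},\quad \mathbf{D}_{\mathbf{E}_1}=\begin{bmatrix}\mathbf{d}_0&\mathbf 0\\ \mathbf 0&\mathbf{D_A}\end{bmatrix},\qquad \mathbf{E}_2=\begin{bmatrix}\mathbf{A}&\mathbf{Y_A}\mathbf{c}_0\\-\mathbf{X_A}&\mathbf{0}\end{bmatrix},\quad \mathbf{D}_{\mathbf{E}_2}=\begin{bmatrix}\mathbf{D_A}&\mathbf 0\\ \mathbf 0&\mathbf{d}_0\end{bmatrix},$$ and $\mathbf{e}_1(z)=z\mathbf{d}_0\mathbf{a}(z)+\mathbf{c}_0$,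 $\mathbf{e}_2(z)=z\mathbf{a}(z)\mathbf{d}_0+\mathbf{c}_0$. Then $$\det(z\mathbf{D}_{\mathbf{E}_1}-\mathbf{E}_1)=\det\mathbf{e}_1(z),\qquad \det(z\mathbf{D}_{\mathbf{E}_2}-\mathbf{E}_2)=\det\mathbf{e}_2(z).$$ Moreover, $$\begin{bmatrix}\mathbf{0}&-\mathbf{X_A}\end{bmatrix}(z\mathbf{D}_{\mathbf{E}_1}-\mathbf{E}_1)^{-1}\begin{bmatrix}\mathbf{I}\\\mathbf{0}\end{bmatrix}=\mathbf{e}_1^{-1}(z)\quad\text{for all } z\notin\Lambda(\mathbf{e}_1),$$ $$\begin{bmatrix}\mathbf{0}&\mathbf{I}\end{bmatrix}(z\mathbf{D}_{\mathbf{E}_2}-\mathbf{E}_2)^{-1}\begin{bmatrix}-\mathbf{Y_A}\\\mathbf{0}\end{bmatrix}=\mathbf{e}_2^{-1}(z)\quad\text{for all } z\notin\Lambda(\mathbf{e}_2),$$ where $\mathbf{I}$ is the $r\times r$ identity.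
   Context: For a matrix polynomial $\mathbf{p}(z)\in\mathbb{C}[z]^{r\times r}$, $\Lambda(\mathbf{p})=\{z\in\mathbb{C}:\det\mathbf{p}(z)=0\}$ is its spectrum, and $\mathbf{p}^{-1}(z)$ denotes the matrix inverse $(\mathbf{p}(z))^{-1}$. *)

theory Defs
  imports
    "HOL-Computational_Algebra.Polynomial"
    "Jordan_Normal_Form.Gauss_Jordan_Elimination"
    "Jordan_Normal_Form.Determinant"
begin

text \<open>A matrix polynomial in $C[z]^{r \times r}$ is a matrix with polynomial entries.\<close>

definition mat_poly_eval :: "complex poly mat \<Rightarrow> complex \<Rightarrow> complex mat" where
  "mat_poly_eval p z = map_mat (\<lambda>q. poly q z) p"

text \<open>
  The largest power of $z$ with a nonzero matrix coefficient, that is, the largest entry degree.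
  It is only meaningful for matrices with at least one entry; the zero matrix polynomial gets
  degree 0.
\<close>

definition mat_poly_degree :: "complex poly mat \<Rightarrow> nat" where
  "mat_poly_degree p = Max (degree ` elements_mat p)"

definition mat_poly_spectrum :: "complex poly mat \<Rightarrow> complex set" where
  "mat_poly_spectrum p = {z. det (mat_poly_eval p z) = 0}"

definition const_mat_poly :: "complex mat \<Rightarrow> complex poly mat" where
  "const_mat_poly M = map_mat (\<lambda>x. [:x:]) M"

text \<open>
  Total version of \<^const>\<open>mat_inverse\<close>: the usual inverse of an invertible square matrix,
  unspecified on singular matrices.
\<close>

definition mat_inv :: "complex mat \<Rightarrow> complex mat" where
  "mat_inv M = the (mat_inverse M)"

definition append_cols :: "'a :: zero mat \<Rightarrow> 'a mat \<Rightarrow> 'a mat" where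
  "append_cols A B = four_block_mat A B (0\<^sub>m 0 (dim_col A)) (0\<^sub>m 0 (dim_col B))"

end

theory Submission
  imports Defs
begin

text \<open>
  Where \<open>W = z D_A - A\<close> is invertible, block elimination with the Schur complement of \<open>W\<close> reduces
  each enlarged pencil to \<open>e_1\<close> or \<open>e_2\<close>, because the Schur complement contains exactly
  \<open>X_A W\<inverse> Y_A = a\<inverse>\<close>. At the finitely many remaining points both sides agree because, after
  replacing inverses by adjugates, they are polynomials in \<open>z\<close>.
\<close>

section \<open>Inverses of complex matrices and their uniqueness\<close>

lemma mat_inv:
  assumes "M \<in> carrier_mat n n" and "det M \<noteq> 0"
  shows "mat_inv M \<in> carrier_mat n n" "M * mat_inv M = 1\<^sub>m n" "mat_inv M * M = 1\<^sub>m n"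
proof -
  have "M \<in> Units (ring_mat TYPE(complex) n ())"
    using det_non_zero_imp_unit[OF assms] .
  \<comment> \<open>Being a unit rules out the \<open>None\<close> case, so \<open>the\<close> in
    \<open>mat_inv\<close> returns a genuine two-sided inverse.\<close>
  then obtain B where "mat_inverse M = Some B"
    using mat_inverse(1)[OF assms(1), of "()"] by (cases "mat_inverse M") auto
  then have "mat_inv M = B" "M * B = 1\<^sub>m n \<and> B * M = 1\<^sub>m n \<and> B \<in> carrier_mat n n"
    using mat_inverse(2)[OF assms(1)] by (auto simp: mat_inv_def)
  then show "mat_inv M \<in> carrier_mat n n" "M * mat_inv M = 1\<^sub>m n" "mat_inv M * M = 1\<^sub>m n"
    by auto
qed

lemma one_smult_mat: "(1 :: 'a :: monoid_mult) \<cdot>\<^sub>m A = A"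
  by (intro eq_matI) auto

lemma assoc_mult_mat4:
  assumes "A \<in> carrier_mat n1 n2" "B \<in> carrier_mat n2 n3"
    "C \<in> carrier_mat n3 n4" "D \<in> carrier_mat n4 n5"
  shows "A * B * C * D = A * (B * (C * D))"
  using assms assoc_mult_mat[OF mult_carrier_mat[OF assms(1,2)] assms(3,4)]
    assoc_mult_mat[OF assms(1,2) mult_carrier_mat[OF assms(3,4)]] by simp

text \<open>The scalar \<open>k\<close> lets one argument cover true left inverses
  (\<open>k = 1\<close>) and the adjugate, where \<open>k\<close> is the determinant.\<close>

lemma mat_inv_unique_left:
  assumes M: "M \<in> carrier_mat n n" and N: "N \<in> carrier_mat n n"
    and det: "det M \<noteq> 0" and NM: "N * M = k \<cdot>\<^sub>m 1\<^sub>m n"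
  shows "N = k \<cdot>\<^sub>m mat_inv M"
proof -
  note I = mat_inv[OF M det]
  have "N = N * (M * mat_inv M)" using N I by simp
  also have "\<dots> = (N * M) * mat_inv M" using N M I by (simp add: assoc_mult_mat)
  also have "\<dots> = k \<cdot>\<^sub>m mat_inv M"
    unfolding NM using mult_smult_assoc_mat[OF one_carrier_mat I(1)] I(1) by simp
  finally show ?thesis .
qed

lemma mat_inv_unique_right:
  assumes M: "M \<in> carrier_mat n n" and N: "N \<in> carrier_mat n n"
    and det: "det M \<noteq> 0" and MN: "M * N = 1\<^sub>m n"
  shows "N = mat_inv M"
proof -
  note I = mat_inv[OF M det]
  have "N = (mat_inv M * M) * N" using N I by simp
  also have "\<dots> = mat_inv M * (M * N)" by (rule assoc_mult_mat[OF I(1) M N])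
  also have "\<dots> = mat_inv M" using MN I by simp
  finally show ?thesis .
qed

subsection \<open>Block rows and columns\<close>

lemma append_cols_carrier:
  assumes "A \<in> carrier_mat nr nc1" "B \<in> carrier_mat nr nc2"
  shows "append_cols A B \<in> carrier_mat nr (nc1 + nc2)"
  using assms unfolding append_cols_def carrier_mat_def by simp

text \<open>\<open>append_rows\<close> is a block matrix whose second block column has width zero,
  so the general block product rule applies. \<open>append_cols\<close> is treated dually, with a
  block row of height zero.\<close>

lemma four_block_mat_mult_append_rows:
  fixes A :: "'a :: semiring_0 mat"
  assumes A: "A \<in> carrier_mat nr1 n1" "B \<in> carrier_mat nr1 n2"
    "C \<in> carrier_mat nr2 n1" "D \<in> carrier_mat nr2 n2"
    and P: "P \<in> carrier_mat n1 nc" "Q \<in> carrier_mat n2 nc"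
  shows "four_block_mat A B C D * append_rows P Q = append_rows (A * P + B * Q) (C * P + D * Q)"
proof -
  have z: "0\<^sub>m n1 0 \<in> carrier_mat n1 0" "0\<^sub>m n2 0 \<in> carrier_mat n2 0" by auto
  have d: "dim_row P = n1" "dim_row Q = n2" "dim_row A = nr1" "dim_row C = nr2"
    "dim_row B = nr1" "dim_row D = nr2" "dim_col P = nc" "dim_col Q = nc" using A P by auto
  show ?thesis
    unfolding append_rows_def d mult_four_block_mat[OF A P(1) z(1) P(2) z(2)]
    using A P by (intro cong_four_block_mat) auto
qed

lemma append_cols_mult_four_block_mat:
  fixes A :: "'a :: semiring_0 mat"
  assumes A: "A \<in> carrier_mat n1 nc1" "B \<in> carrier_mat n1 nc2"
    "C \<in> carrier_mat n2 nc1" "D \<in> carrier_mat n2 nc2"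
    and P: "P \<in> carrier_mat nr n1" "Q \<in> carrier_mat nr n2"
  shows "append_cols P Q * four_block_mat A B C D = append_cols (P * A + Q * C) (P * B + Q * D)"
proof -
  have z: "0\<^sub>m 0 n1 \<in> carrier_mat 0 n1" "0\<^sub>m 0 n2 \<in> carrier_mat 0 n2" by auto
  have d: "dim_col P = n1" "dim_col Q = n2" using P by auto
  show ?thesis
    unfolding append_cols_def d mult_four_block_mat[OF P z A]
    using A P by (intro cong_four_block_mat) auto
qed

lemma append_cols_mult_append_rows:
  fixes P :: "'a :: semiring_0 mat"
  assumes P: "P \<in> carrier_mat nr n1" "Q \<in> carrier_mat nr n2"
    and U: "U \<in> carrier_mat n1 nc" "V \<in> carrier_mat n2 nc"
  shows "append_cols P Q * append_rows U V = P * U + Q * V"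
proof -
  have z: "0\<^sub>m 0 n1 \<in> carrier_mat 0 n1" "0\<^sub>m 0 n2 \<in> carrier_mat 0 n2"
    "0\<^sub>m n1 0 \<in> carrier_mat n1 0" "0\<^sub>m n2 0 \<in> carrier_mat n2 0" by auto
  have d: "dim_col P = n1" "dim_col Q = n2" "dim_row U = n1" "dim_row V = n2" using P U by auto
  show ?thesis
    unfolding append_cols_def append_rows_def d mult_four_block_mat[OF P z(1,2) U(1) z(3) U(2) z(4)]
    using P U by (intro eq_matI) auto
qed

lemma append_rows_mult:
  fixes U :: "'a :: semiring_0 mat"
  assumes U: "U \<in> carrier_mat nr1 n" "V \<in> carrier_mat nr2 n" and E: "E \<in> carrier_mat n nc"
  shows "append_rows U V * E = append_rows (U * E) (V * E)"
proof -
  \<comment> \<open>\<open>E\<close> is padded with an empty lower block so that it matches the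
    zero-width column hidden in \<open>append_rows U V\<close>.\<close>
  have "append_rows U V * append_rows E (0\<^sub>m 0 nc) = append_rows (U * E) (V * E)"
    unfolding append_rows_def[of U V]
    by (subst four_block_mat_mult_append_rows[OF U(1) _ U(2) _ E], use U E in auto)
  moreover have "append_rows E (0\<^sub>m 0 nc) = E"
    using E unfolding append_rows_def by (intro eq_matI) auto
  ultimately show ?thesis by simp
qed

lemma mult_append_cols:
  fixes U :: "'a :: semiring_0 mat"
  assumes U: "U \<in> carrier_mat n nc1" "V \<in> carrier_mat n nc2" and E: "E \<in> carrier_mat nr n"
  shows "E * append_cols U V = append_cols (E * U) (E * V)"
proof -
  have "append_cols E (0\<^sub>m nr 0) * append_cols U V = append_cols (E * U) (E * V)"
    unfolding append_cols_def[of U V]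
    by (subst append_cols_mult_four_block_mat[OF U _ _ E], use U E in auto)
  moreover have "append_cols E (0\<^sub>m nr 0) = E"
    using E unfolding append_cols_def by (intro eq_matI) auto
  ultimately show ?thesis by simp
qed

subsection \<open>Schur complements\<close>

text \<open>\<open>M\<close> is the value of the first pencil at a point, with \<open>z d0\<close>
  in the role of \<open>D\<close>. The Schur complement of \<open>W\<close> in \<open>M\<close> is
  \<open>D + c X W^-1 Y\<close>, which is \<open>D + c a^-1\<close>; multiplying it by
  \<open>a\<close> on the right gives \<open>e\<close>. Hence the elimination acts on block
  columns.\<close>

lemma first_pencil_pointwise:
  fixes a c D W X Y :: "complex mat"
  assumes a: "a \<in> carrier_mat r r" and W: "W \<in> carrier_mat n n"
    and X: "X \<in> carrier_mat r n" and Y: "Y \<in> carrier_mat n r"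
    and c: "c \<in> carrier_mat r r" and D: "D \<in> carrier_mat r r"
    and det_W: "det W = det a" and det_a: "det a \<noteq> 0"
    and inv: "mat_inv a = X * mat_inv W * Y"
  defines "M \<equiv> four_block_mat D (- (c * X)) Y W"
    and "e \<equiv> D * a + c"
  shows "det M = det e"
    and "det e \<noteq> 0 \<Longrightarrow>
      append_cols (0\<^sub>m r r) (- X) * mat_inv M * append_rows (1\<^sub>m r) (0\<^sub>m n r) = mat_inv e"
proof -
  define V where "V = mat_inv W"
  have V: "V \<in> carrier_mat n n" "W * V = 1\<^sub>m n"
    using mat_inv[OF W] det_W det_a by (auto simp: V_def)
  \<comment> \<open>The solution of \<open>Y * a + W * L = 0\<close>: adding the second block column
    times \<open>L\<close> to the first one times \<open>a\<close> clears the lower left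
    block.\<close>
  define L where "L = - (V * (Y * a))"
  have L: "L \<in> carrier_mat n r" using V Y a by (auto simp: L_def)
  have M: "M \<in> carrier_mat (r + n) (r + n)" using D W by (simp add: M_def)
  have e: "e \<in> carrier_mat r r" using D a c by (simp add: e_def)
  have cX: "- (c * X) \<in> carrier_mat r n" using c X by auto
  have XVYa: "X * (V * (Y * a)) = 1\<^sub>m r"
  proof -
    have "X * (V * (Y * a)) = (X * V * Y) * a"
      using X V Y a by (simp add: assoc_mult_mat[of _ r n _ n] assoc_mult_mat[of _ r n _ r])
    also have "\<dots> = 1\<^sub>m r" using mat_inv(3)[OF a det_a] inv by (simp add: V_def)
    finally show ?thesis .
  qed
  have XL: "X * L = - 1\<^sub>m r"
    using XVYa X V Y a by (simp add: L_def)
  have WL: "W * L = - (Y * a)"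
  proof -
    have "W * L = - ((W * V) * (Y * a))"
      using W V(1) Y a by (simp add: L_def assoc_mult_mat[of W n n V n "Y * a" r])
    then show ?thesis using V Y a by simp
  qed
  have upper: "D * a + - (c * X) * L = e"
  proof -
    have "- (c * X) * L = - (c * (X * L))" using c X L by (simp add: assoc_mult_mat)
    also have "\<dots> = c" using XL c by simp
    finally show ?thesis by (simp add: e_def)
  qed
  have lower: "Y * a + W * L = 0\<^sub>m n r"
    using WL Y a by (intro eq_matI) auto
  \<comment> \<open>The upper left block is \<open>a\<close> instead of the identity, so that
    \<open>e\<close> itself appears in the product. The price is a factor \<open>det a\<close>,
    which cancels against \<open>det W\<close>.\<close>
  define T where "T = four_block_mat a (0\<^sub>m r n) L (1\<^sub>m n)"
  have T: "T \<in> carrier_mat (r + n) (r + n)" using a by (simp add: T_def)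
  have "M * T = four_block_mat e (- (c * X)) (0\<^sub>m n r) W"
    unfolding M_def T_def
    using mult_four_block_mat[OF D cX Y W a zero_carrier_mat L one_carrier_mat]
      upper lower D Y W right_mult_one_mat[OF cX] left_add_zero_mat[OF cX] by simp
  then have "det (M * T) = det e * det W"
    using det_four_block_mat_lower_left_zero[OF e cX refl W] by simp
  moreover have "det T = det a"
    using det_four_block_mat_upper_right_zero[OF a refl L one_carrier_mat] by (simp add: T_def)
  ultimately have "det M * det a = det e * det a"
    using det_mult[OF M T] det_W by simp
  then show det_M: "det M = det e" using det_a by simp

  assume det_e: "det e \<noteq> 0"
  let ?B = "append_cols (0\<^sub>m r r) (- X)" and ?C = "append_rows (1\<^sub>m r) (0\<^sub>m n r)"
  let ?U = "append_rows a L"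
  have B: "?B \<in> carrier_mat r (r + n)" using X by (intro append_cols_carrier) auto
  have C: "?C \<in> carrier_mat (r + n) r" by auto
  have U: "?U \<in> carrier_mat (r + n) r" using a L by auto
  have MI: "mat_inv M \<in> carrier_mat (r + n) (r + n)" "mat_inv M * M = 1\<^sub>m (r + n)"
    using mat_inv[OF M] det_M det_e by auto
  \<comment> \<open>This is the first block column of \<open>M * T\<close>. It exhibits
    \<open>?U\<close> as the solution of the linear system with right-hand side
    \<open>?C * e\<close>, so that \<open>mat_inv M * ?C * e\<close> equals
    \<open>?U\<close>.\<close>
  have MU: "M * ?U = ?C * e"
    unfolding M_def four_block_mat_mult_append_rows[OF D cX Y W a L] upper lower
    using append_rows_mult[OF one_carrier_mat zero_carrier_mat e, of n] e by simp
  have "?B * mat_inv M * ?C * e = ?B * (mat_inv M * (?C * e))"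
    by (rule assoc_mult_mat4[OF B MI(1) C e])
  also have "\<dots> = ?B * (mat_inv M * M * ?U)"
    unfolding MU[symmetric] using assoc_mult_mat[OF MI(1) M U] by simp
  also have "\<dots> = ?B * ?U" using MI U by simp
  \<comment> \<open>Only the lower block \<open>L\<close> of \<open>?U\<close> survives, and
    \<open>- X * L\<close> is the identity since \<open>X * L\<close> is minus the identity.\<close>
  also have "\<dots> = 1\<^sub>m r"
    using append_cols_mult_append_rows[of "0\<^sub>m r r" r r "- X" n a r L] X a L XL by simp
  finally show "?B * mat_inv M * ?C = mat_inv e"
    using mat_inv_unique_left[OF e mult_carrier_mat[OF mult_carrier_mat[OF B MI(1)] C] det_e, of 1]
    by (simp only: one_smult_mat)
qed

text \<open>Mirror image of the first pencil: the Schur complement is \<open>D + X W^-1 Y c\<close>,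
  that is \<open>D + a^-1 c\<close>, and \<open>a\<close> must now multiply from the left to give
  \<open>e\<close>. The elimination therefore acts on block rows.\<close>

lemma second_pencil_pointwise:
  fixes a c D W X Y :: "complex mat"
  assumes a: "a \<in> carrier_mat r r" and W: "W \<in> carrier_mat n n"
    and X: "X \<in> carrier_mat r n" and Y: "Y \<in> carrier_mat n r"
    and c: "c \<in> carrier_mat r r" and D: "D \<in> carrier_mat r r"
    and det_W: "det W = det a" and det_a: "det a \<noteq> 0"
    and inv: "mat_inv a = X * mat_inv W * Y"
  defines "M \<equiv> four_block_mat W (- (Y * c)) X D"
    and "e \<equiv> a * D + c"
  shows "det M = det e"
    and "det e \<noteq> 0 \<Longrightarrow>
      append_cols (0\<^sub>m r n) (1\<^sub>m r) * mat_inv M * append_rows (- Y) (0\<^sub>m r r) = mat_inv e"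
proof -
  define V where "V = mat_inv W"
  have V: "V \<in> carrier_mat n n" "V * W = 1\<^sub>m n"
    using mat_inv[OF W] det_W det_a by (auto simp: V_def)
  \<comment> \<open>The solution of \<open>L * W + a * X = 0\<close>, which clears the lower left
    block after left multiplication by \<open>T\<close>.\<close>
  define L where "L = - (a * X * V)"
  have L: "L \<in> carrier_mat r n" using V X a by (auto simp: L_def)
  have M: "M \<in> carrier_mat (n + r) (n + r)" using D W by (simp add: M_def)
  have e: "e \<in> carrier_mat r r" using D a c by (simp add: e_def)
  have Yc: "- (Y * c) \<in> carrier_mat n r" using c Y by auto
  have aXVY: "a * X * V * Y = 1\<^sub>m r"
  proof -
    have "a * X * V * Y = a * (X * V * Y)"
      using X V Y a
      by (simp add: assoc_mult_mat[of _ r n _ n] assoc_mult_mat[of _ r n _ r]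
          assoc_mult_mat[of _ r r _ n])
    also have "\<dots> = 1\<^sub>m r" using mat_inv(2)[OF a det_a] inv by (simp add: V_def)
    finally show ?thesis .
  qed
  have LY: "L * Y = - 1\<^sub>m r"
    using aXVY X V Y a by (simp add: L_def)
  have LW: "L * W = - (a * X)"
  proof -
    have "L * W = - (a * X * (V * W))"
      unfolding L_def using W V(1) X a assoc_mult_mat[of "a * X" r n V n W n]
      by (simp del: assoc_mult_mat)
    then show ?thesis using V X a by simp
  qed
  have right: "L * - (Y * c) + a * D = e"
  proof -
    have "L * - (Y * c) = - (L * Y * c)" using c Y L by (simp add: assoc_mult_mat)
    also have "\<dots> = c" using LY c by simp
    finally show ?thesis using c a D by (simp add: e_def comm_add_mat[of c r r])
  qed
  have left: "L * W + a * X = 0\<^sub>m r n"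
    using LW X a by (intro eq_matI) auto
  define T where "T = four_block_mat (1\<^sub>m n) (0\<^sub>m n r) L a"
  have T: "T \<in> carrier_mat (n + r) (n + r)" using a by (simp add: T_def)
  have "T * M = four_block_mat W (- (Y * c)) (0\<^sub>m r n) e"
    unfolding M_def T_def
    using mult_four_block_mat[OF one_carrier_mat zero_carrier_mat L a W Yc X D]
      right left D X W left_mult_one_mat[OF Yc] right_add_zero_mat[OF Yc] by simp
  then have "det (T * M) = det W * det e"
    using det_four_block_mat_lower_left_zero[OF W Yc refl e] by simp
  moreover have "det T = det a"
    using det_four_block_mat_upper_right_zero[OF one_carrier_mat refl L a] by (simp add: T_def)
  ultimately have "det a * det M = det a * det e"
    using det_mult[OF T M] det_W by simp
  then show det_M: "det M = det e" using det_a by simp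

  assume det_e: "det e \<noteq> 0"
  let ?B = "append_cols (0\<^sub>m r n) (1\<^sub>m r)" and ?C = "append_rows (- Y) (0\<^sub>m r r)"
  let ?U = "append_cols L a"
  have B: "?B \<in> carrier_mat r (n + r)" by (intro append_cols_carrier) auto
  have C: "?C \<in> carrier_mat (n + r) r" using Y by auto
  have U: "?U \<in> carrier_mat r (n + r)" using a L by (intro append_cols_carrier)
  have MI: "mat_inv M \<in> carrier_mat (n + r) (n + r)" "M * mat_inv M = 1\<^sub>m (n + r)"
    using mat_inv[OF M] det_M det_e by auto
  \<comment> \<open>The second block row of \<open>T * M\<close>. Since \<open>e\<close> now stands
    on the left, the computation below yields a right inverse of \<open>e\<close>.\<close>
  have UM: "?U * M = e * ?B"
    unfolding M_def append_cols_mult_four_block_mat[OF W Yc X D L a] right left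
    using mult_append_cols[OF zero_carrier_mat one_carrier_mat e, of n] e by simp
  have "e * (?B * mat_inv M * ?C) = (e * ?B) * mat_inv M * ?C"
    using assoc_mult_mat4[OF e B MI(1) C] assoc_mult_mat[OF B MI(1) C] by simp
  also have "\<dots> = ?U * (M * mat_inv M) * ?C"
    unfolding UM[symmetric] using assoc_mult_mat[OF U M MI(1)] by simp
  also have "\<dots> = ?U * ?C" using MI U by simp
  also have "\<dots> = 1\<^sub>m r"
    using append_cols_mult_append_rows[of L r n a r "- Y" r "0\<^sub>m r r"] Y a L LY by simp
  finally show "?B * mat_inv M * ?C = mat_inv e"
    by (rule mat_inv_unique_right[OF e mult_carrier_mat[OF mult_carrier_mat[OF B MI(1)] C] det_e])
qed

subsection \<open>Extension to all points by polynomial identity\<close>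

lemma comm_ring_hom_poly_eval: "comm_ring_hom (\<lambda>q :: 'a :: comm_ring_1 poly. poly q z)"
  by unfold_locales auto

text \<open>The product \<open>d * (p - q)\<close> vanishes at the roots of \<open>d\<close> as
  well, hence everywhere, so it is the zero polynomial; the factor \<open>d\<close> cancels because
  there are no zero divisors.\<close>

lemma poly_eqI_off_roots:
  fixes p q d :: "complex poly"
  assumes "d \<noteq> 0" and "\<And>z. poly d z \<noteq> 0 \<Longrightarrow> poly p z = poly q z"
  shows "p = q"
proof -
  have "poly (d * (p - q)) z = 0" for z using assms(2)[of z] by auto
  then have "d * (p - q) = 0" using poly_all_0_iff_0 by blast
  with assms(1) show ?thesis by simp
qed

section \<open>Evaluation of matrix polynomials and the adjugate\<close>

lemma mat_poly_eval_carrier [simp]: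
  "p \<in> carrier_mat nr nc \<Longrightarrow> mat_poly_eval p z \<in> carrier_mat nr nc"
  by (simp add: mat_poly_eval_def)

lemma const_mat_poly_carrier [simp]:
  "M \<in> carrier_mat nr nc \<Longrightarrow> const_mat_poly M \<in> carrier_mat nr nc"
  by (simp add: const_mat_poly_def)

lemma mat_poly_eval_const [simp]: "mat_poly_eval (const_mat_poly M) z = M"
  by (intro eq_matI) (auto simp: mat_poly_eval_def const_mat_poly_def)

lemma mat_poly_eval_mult:
  assumes "p \<in> carrier_mat nr n" "q \<in> carrier_mat n nc"
  shows "mat_poly_eval (p * q) z = mat_poly_eval p z * mat_poly_eval q z"
proof -
  interpret comm_ring_hom "\<lambda>q :: complex poly. poly q z" by (rule comm_ring_hom_poly_eval)
  show ?thesis using mat_hom_mult[OF assms] by (simp add: mat_poly_eval_def)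
qed

lemma det_mat_poly_eval: "det (mat_poly_eval p z) = poly (det p) z"
proof -
  interpret comm_ring_hom "\<lambda>q :: complex poly. poly q z" by (rule comm_ring_hom_poly_eval)
  show ?thesis by (simp add: mat_poly_eval_def)
qed

lemma mat_poly_eqI_off_roots:
  assumes "p \<in> carrier_mat nr nc" "q \<in> carrier_mat nr nc" "d \<noteq> 0"
    and eq: "\<And>z. poly d z \<noteq> 0 \<Longrightarrow> mat_poly_eval p z = mat_poly_eval q z"
  shows "p = q"
proof (rule eq_matI)
  fix i j assume ij: "i < dim_row q" "j < dim_col q"
  show "p $$ (i, j) = q $$ (i, j)"
  proof (rule poly_eqI_off_roots[OF assms(3)])
    fix z assume "poly d z \<noteq> 0"
    from arg_cong[OF eq[OF this], of "\<lambda>m. m $$ (i, j)"]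
    show "poly (p $$ (i, j)) z = poly (q $$ (i, j)) z"
      using ij assms(1,2) by (simp add: mat_poly_eval_def)
  qed
qed (use assms in auto)

text \<open>The inverse is not polynomial in \<open>z\<close>, but its multiple by the determinant
  is: the identity \<open>adj_mat M * M = det M\<close> times the unit matrix survives evaluation
  and determines the value of the adjugate.\<close>

lemma mat_poly_eval_adj_mat:
  assumes M: "M \<in> carrier_mat n n" and det: "det (mat_poly_eval M z) \<noteq> 0"
  shows "mat_poly_eval (adj_mat M) z = det (mat_poly_eval M z) \<cdot>\<^sub>m mat_inv (mat_poly_eval M z)"
proof (rule mat_inv_unique_left[OF _ _ det])
  have "mat_poly_eval (adj_mat M) z * mat_poly_eval M z = mat_poly_eval (det M \<cdot>\<^sub>m 1\<^sub>m n) z"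
    using mat_poly_eval_mult[OF adj_mat(1)[OF M] M] adj_mat(3)[OF M] by simp
  also have "\<dots> = det (mat_poly_eval M z) \<cdot>\<^sub>m 1\<^sub>m n"
    unfolding det_mat_poly_eval by (intro eq_matI) (auto simp: mat_poly_eval_def)
  finally show "mat_poly_eval (adj_mat M) z * mat_poly_eval M z
      = det (mat_poly_eval M z) \<cdot>\<^sub>m 1\<^sub>m n" .
qed (use M adj_mat(1)[OF M] in auto)

text \<open>The roots of \<open>d\<close> are the exceptional points. The determinants are
  polynomials, so their equality extends at once. The resolvent identity becomes polynomial after
  multiplication by \<open>det e\<close>, is extended in that form, and is divided by
  \<open>det e\<close> again at \<open>z\<close>.\<close>

lemma resolvent_identity_extends:
  assumes M: "M \<in> carrier_mat n n" and e: "e \<in> carrier_mat r r"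
    and B: "B \<in> carrier_mat r n" and C: "C \<in> carrier_mat n r"
    and d: "d \<noteq> 0"
    and dets: "\<And>z. poly d z \<noteq> 0 \<Longrightarrow> det (mat_poly_eval M z) = det (mat_poly_eval e z)"
    and res: "\<And>z. poly d z \<noteq> 0 \<Longrightarrow> det (mat_poly_eval e z) \<noteq> 0 \<Longrightarrow>
      B * mat_inv (mat_poly_eval M z) * C = mat_inv (mat_poly_eval e z)"
  shows "det (mat_poly_eval M z) = det (mat_poly_eval e z)"
    and "det (mat_poly_eval e z) \<noteq> 0 \<Longrightarrow>
      B * mat_inv (mat_poly_eval M z) * C = mat_inv (mat_poly_eval e z)"
proof -
  have "det M = det e"
    using poly_eqI_off_roots[OF d, of "det M" "det e"] dets by (simp add: det_mat_poly_eval)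
  then have det_eq: "det (mat_poly_eval M w) = det (mat_poly_eval e w)" for w
    by (simp add: det_mat_poly_eval)
  then show "det (mat_poly_eval M z) = det (mat_poly_eval e z)" .

  assume nz: "det (mat_poly_eval e z) \<noteq> 0"
  let ?R = "const_mat_poly B * adj_mat M * const_mat_poly C"
  \<comment> \<open>The adjugate of \<open>M\<close> brings in the factor \<open>det M\<close>;
    replacing it by the equal \<open>det e\<close> makes \<open>?R\<close> comparable with
    \<open>adj_mat e\<close>.\<close>
  have eval_R: "mat_poly_eval ?R w
      = det (mat_poly_eval e w) \<cdot>\<^sub>m (B * mat_inv (mat_poly_eval M w) * C)"
    if w: "det (mat_poly_eval e w) \<noteq> 0" for w
  proof -
    have I: "mat_inv (mat_poly_eval M w) \<in> carrier_mat n n"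
      using mat_inv(1)[of "mat_poly_eval M w" n] M w det_eq by simp
    have "mat_poly_eval ?R w = B * mat_poly_eval (adj_mat M) w * C"
      using mat_poly_eval_mult[of "const_mat_poly B * adj_mat M" r n "const_mat_poly C" r w]
        mat_poly_eval_mult[of "const_mat_poly B" r n "adj_mat M" n w]
        mult_carrier_mat[OF const_mat_poly_carrier[OF B] adj_mat(1)[OF M]] B C adj_mat(1)[OF M]
      by simp
    also have "\<dots> = det (mat_poly_eval e w) \<cdot>\<^sub>m (B * mat_inv (mat_poly_eval M w) * C)"
      using mat_poly_eval_adj_mat[OF M, of w] w det_eq[of w] B C I
      by (simp add: mult_smult_distrib[of _ r n] mult_smult_assoc_mat[of _ r n])
    finally show ?thesis .
  qed
  have "?R = adj_mat e"
  \<comment> \<open>The factor \<open>det e\<close> also excludes the points where \<open>e\<close>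
    is singular and \<open>res\<close> says nothing. The product is a nonzero polynomial because
    \<open>det e\<close> does not vanish at \<open>z\<close>.\<close>
  proof (rule mat_poly_eqI_off_roots[where d = "d * det e"])
    show "d * det e \<noteq> 0" using d nz by (auto simp: det_mat_poly_eval)
    fix w assume "poly (d * det e) w \<noteq> 0"
    then have w: "poly d w \<noteq> 0" "det (mat_poly_eval e w) \<noteq> 0" by (auto simp: det_mat_poly_eval)
    show "mat_poly_eval ?R w = mat_poly_eval (adj_mat e) w"
      using eval_R[OF w(2)] res[OF w] mat_poly_eval_adj_mat[OF e w(2)] by simp
  qed (use mult_carrier_mat[OF mult_carrier_mat, of "const_mat_poly B" r n
        "adj_mat M" n "const_mat_poly C" r] B C adj_mat(1)[OF M] adj_mat(1)[OF e] in auto)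
  then have "det (mat_poly_eval e z) \<cdot>\<^sub>m (B * mat_inv (mat_poly_eval M z) * C)
      = det (mat_poly_eval e z) \<cdot>\<^sub>m mat_inv (mat_poly_eval e z)"
    using eval_R[OF nz] mat_poly_eval_adj_mat[OF e nz] by simp
  then show "B * mat_inv (mat_poly_eval M z) * C = mat_inv (mat_poly_eval e z)"
    using nz by (auto simp: mat_eq_iff)
qed

section \<open>Pencils as matrix polynomials, and the final assembly\<close>

lemma mat_poly_eval_pencil:
  assumes "D \<in> carrier_mat nr nc" "E \<in> carrier_mat nr nc"
  shows "mat_poly_eval ([:0, 1:] \<cdot>\<^sub>m const_mat_poly D - const_mat_poly E) z = z \<cdot>\<^sub>m D - E"
  using assms by (intro eq_matI) (auto simp: mat_poly_eval_def const_mat_poly_def)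

lemma mat_poly_eval_linear:
  assumes "p \<in> carrier_mat nr nc" "c \<in> carrier_mat nr nc"
  shows "mat_poly_eval ([:0, 1:] \<cdot>\<^sub>m p + const_mat_poly c) z = z \<cdot>\<^sub>m mat_poly_eval p z + c"
  using assms by (intro eq_matI) (auto simp: mat_poly_eval_def const_mat_poly_def)

theorem theorem1:
  fixes r s :: nat
    and a :: "complex poly mat"
    and c0 d0 DA A XA YA :: "complex mat"
  assumes "r \<ge> 1" and "s \<ge> 1"
    and "a \<in> carrier_mat r r" and "mat_poly_degree a = s"
    and "c0 \<in> carrier_mat r r" and "d0 \<in> carrier_mat r r"
    and "DA \<in> carrier_mat (r * s) (r * s)" and "A \<in> carrier_mat (r * s) (r * s)"
    and "XA \<in> carrier_mat r (r * s)" and "YA \<in> carrier_mat (r * s) r"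
    and "\<And>z. det (mat_poly_eval a z) = det (z \<cdot>\<^sub>m DA - A)"
    and "\<exists>z. det (mat_poly_eval a z) \<noteq> 0"
    and "\<And>z. z \<notin> mat_poly_spectrum a \<Longrightarrow>
           mat_inv (mat_poly_eval a z) = XA * mat_inv (z \<cdot>\<^sub>m DA - A) * YA"
  defines "E1 \<equiv> four_block_mat (0\<^sub>m r r) (c0 * XA) (- YA) A"
    and "DE1 \<equiv> four_block_mat d0 (0\<^sub>m r (r * s)) (0\<^sub>m (r * s) r) DA"
    and "E2 \<equiv> four_block_mat A (YA * c0) (- XA) (0\<^sub>m r r)"
    and "DE2 \<equiv> four_block_mat DA (0\<^sub>m (r * s) r) (0\<^sub>m r (r * s)) d0"
    and "e1 \<equiv> [:0, 1:] \<cdot>\<^sub>m (const_mat_poly d0 * a) + const_mat_poly c0"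
    and "e2 \<equiv> [:0, 1:] \<cdot>\<^sub>m (a * const_mat_poly d0) + const_mat_poly c0"
  shows "(\<forall>z. det (z \<cdot>\<^sub>m DE1 - E1) = det (mat_poly_eval e1 z))
    \<and> (\<forall>z. det (z \<cdot>\<^sub>m DE2 - E2) = det (mat_poly_eval e2 z))
    \<and> (\<forall>z. z \<notin> mat_poly_spectrum e1 \<longrightarrow>
         append_cols (0\<^sub>m r r) (- XA) * mat_inv (z \<cdot>\<^sub>m DE1 - E1)
           * append_rows (1\<^sub>m r) (0\<^sub>m (r * s) r)
         = mat_inv (mat_poly_eval e1 z))
    \<and> (\<forall>z. z \<notin> mat_poly_spectrum e2 \<longrightarrow>
         append_cols (0\<^sub>m r (r * s)) (1\<^sub>m r) * mat_inv (z \<cdot>\<^sub>m DE2 - E2)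
           * append_rows (- YA) (0\<^sub>m r r)
         = mat_inv (mat_poly_eval e2 z))"
proof -
  note a = assms(3) and c0 = assms(5) and d0 = assms(6) and DA = assms(7) and A = assms(8)
    and X = assms(9) and Y = assms(10)
  let ?n = "r * s"
  define W where "W z = z \<cdot>\<^sub>m DA - A" for z
  have W: "W z \<in> carrier_mat ?n ?n" for z using DA A by (simp add: W_def minus_carrier_mat)
  have d: "det a \<noteq> 0" using assms(12) by (auto simp: det_mat_poly_eval)
  have az: "mat_poly_eval a z \<in> carrier_mat r r" for z using a by simp
  have zd: "z \<cdot>\<^sub>m d0 \<in> carrier_mat r r" for z using d0 by simp
  have det_W: "det (W z) = det (mat_poly_eval a z)" for z using assms(11) by (simp add: W_def)
  have inv: "mat_inv (mat_poly_eval a z) = XA * mat_inv (W z) * YA"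
    if "det (mat_poly_eval a z) \<noteq> 0" for z
    using assms(13)[of z] that by (simp add: mat_poly_spectrum_def W_def)

  \<comment> \<open>The pencils are recast as matrix polynomials, with \<open>[:0, 1:]\<close> as
    the indeterminate, so that the extension lemma can compare them with \<open>e1\<close> and
    \<open>e2\<close>.\<close>
  define P1 where "P1 = [:0, 1:] \<cdot>\<^sub>m const_mat_poly DE1 - const_mat_poly E1"
  define P2 where "P2 = [:0, 1:] \<cdot>\<^sub>m const_mat_poly DE2 - const_mat_poly E2"
  have DE1: "DE1 \<in> carrier_mat (r + ?n) (r + ?n)" and E1: "E1 \<in> carrier_mat (r + ?n) (r + ?n)"
    and DE2: "DE2 \<in> carrier_mat (?n + r) (?n + r)" and E2: "E2 \<in> carrier_mat (?n + r) (?n + r)"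
    using d0 DA A by (simp_all add: DE1_def E1_def DE2_def E2_def)
  have P1: "P1 \<in> carrier_mat (r + ?n) (r + ?n)" and P2: "P2 \<in> carrier_mat (?n + r) (?n + r)"
    using DE1 E1 DE2 E2 by (auto simp: P1_def P2_def intro!: minus_carrier_mat)
  have eval_P1: "mat_poly_eval P1 z = z \<cdot>\<^sub>m DE1 - E1" for z
    unfolding P1_def by (rule mat_poly_eval_pencil[OF DE1 E1])
  have eval_P2: "mat_poly_eval P2 z = z \<cdot>\<^sub>m DE2 - E2" for z
    unfolding P2_def by (rule mat_poly_eval_pencil[OF DE2 E2])
  \<comment> \<open>Subtracting \<open>E1\<close> flips the signs of its off-diagonal blocks, which
    gives the shape of \<open>M\<close> in the pointwise lemma.\<close>
  have block1: "mat_poly_eval P1 z = four_block_mat (z \<cdot>\<^sub>m d0) (- (c0 * XA)) YA (W z)" for z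
    unfolding eval_P1 DE1_def E1_def W_def
    using d0 c0 DA A X Y by (intro eq_matI) auto
  have block2: "mat_poly_eval P2 z = four_block_mat (W z) (- (YA * c0)) XA (z \<cdot>\<^sub>m d0)" for z
    unfolding eval_P2 DE2_def E2_def W_def
    using d0 c0 DA A X Y by (intro eq_matI) auto
  have e1: "e1 \<in> carrier_mat r r" and e2: "e2 \<in> carrier_mat r r"
    using a c0 d0 by (auto simp: e1_def e2_def intro!: mult_carrier_mat[of _ r r])
  \<comment> \<open>The scalar \<open>z\<close> is moved onto \<open>d0\<close>, matching
    \<open>D * a + c\<close> with \<open>D\<close> equal to \<open>z d0\<close>.\<close>
  have eval_e1: "mat_poly_eval e1 z = (z \<cdot>\<^sub>m d0) * mat_poly_eval a z + c0" for z
    using mat_poly_eval_linear[OF mult_carrier_mat[of "const_mat_poly d0" r r "a" r] c0, of z]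
      mat_poly_eval_mult[of "const_mat_poly d0" r r "a" r z]
      mult_smult_assoc_mat[of "d0" r r "mat_poly_eval a z" r z] a d0
    by (simp add: e1_def)
  have eval_e2: "mat_poly_eval e2 z = mat_poly_eval a z * (z \<cdot>\<^sub>m d0) + c0" for z
    using mat_poly_eval_linear[OF mult_carrier_mat[of "a" r r "const_mat_poly d0" r] c0, of z]
      mat_poly_eval_mult[of "a" r r "const_mat_poly d0" r z]
      mult_smult_distrib[of "mat_poly_eval a z" r r "d0" r z] a d0
    by (simp add: e2_def)

  note pw1 = first_pencil_pointwise[OF az W X Y c0 zd det_W, of z z for z, folded block1 eval_e1]
  note pw2 = second_pencil_pointwise[OF az W X Y c0 zd det_W, of z z for z, folded block2 eval_e2]
  have B1: "append_cols (0\<^sub>m r r) (- XA) \<in> carrier_mat r (r + ?n)"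
    and B2: "append_cols (0\<^sub>m r ?n) (1\<^sub>m r) \<in> carrier_mat r (?n + r)"
    using X by (auto intro!: append_cols_carrier)
  have C1: "append_rows (1\<^sub>m r) (0\<^sub>m ?n r) \<in> carrier_mat (r + ?n) r"
    and C2: "append_rows (- YA) (0\<^sub>m r r) \<in> carrier_mat (?n + r) r"
    using Y by auto
  have nz: "det (mat_poly_eval a z) \<noteq> 0" if "poly (det a) z \<noteq> 0" for z
    using that by (simp add: det_mat_poly_eval)
  \<comment> \<open>Here \<open>d\<close> is \<open>det a\<close>: off its roots \<open>W z\<close>
    is invertible and the pointwise lemmas apply. The extension adds the points of the spectrum of
    \<open>a\<close>, for the resolvent those where \<open>e1\<close> or \<open>e2\<close> is
    invertible.\<close>
  note ext1 = resolvent_identity_extends[OF P1 e1 B1 C1 d,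
      OF pw1(1)[OF nz inv[OF nz]] pw1(2)[OF nz inv[OF nz]], unfolded eval_P1]
  note ext2 = resolvent_identity_extends[OF P2 e2 B2 C2 d,
      OF pw2(1)[OF nz inv[OF nz]] pw2(2)[OF nz inv[OF nz]], unfolded eval_P2]
  show ?thesis
    using ext1 ext2 by (auto simp: mat_poly_spectrum_def)
qed

end
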